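(* Let $G$ be a 2-connected $o$-heavy graph on $n\geq 3$ vertices. Suppose that for every induced subgraph $H$ of $G$ isomorphic to $Z_2$ and every pair of vertices $u,v\in V(H)$ with $d_H(u,v)=2$, we have $\max\{d(u),d(v)\}\geq n/2$ or $|N(u)\cap N(v)|\geq 2$. Then $G$ is Hamiltonian.
   Context: All graphs are finite and simple; $d(x)$ and $N(x)$ denote the degree and neighborhood of $x$ in $G$, and $d_H(u,v)$ is the distance between $u$ and $v$ in $H$. A claw is $K_{1,3}$; its degree-3 vertex is the center and the other three are end-vertices. A graph $G$ on $n\geq 3$ vertices is $o$-heavy if every induced claw of $G$ has two end-vertices $x,y$ with $d(x)+d(y)\geq n$. $Z_2$ is the graph obtained from a triangle by attaching a path of length 2 to one vertex of the triangle (i.e. vertices $a_1,a_2,a_3,b_1,c_1$ with edges $a_1a_2,a_1a_3,a_2a_3,a_1b_1,b_1c_1$). *)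

theory Defs
  imports "Graph_Theory.Graph_Theory"
begin

text \<open>A finite simple graph is a finite, symmetric, loop-free digraph without parallel arcs
  (\<^locale>\<open>pair_graph\<close>): each edge is present as both of its orientations, so that the number of arcs
  leaving a vertex is its degree.\<close>

abbreviation degree :: "'a pair_pre_digraph \<Rightarrow> 'a \<Rightarrow> nat" where
  "degree G x \<equiv> out_degree (with_proj G) x"

definition nbhd :: "'a pair_pre_digraph \<Rightarrow> 'a \<Rightarrow> 'a set" where
  "nbhd G x = {y. (x, y) \<in> parcs G}"

text \<open>The library's weighted distance with unit weights: the least number of arcs of a walk
  from \<open>u\<close> to \<open>v\<close>, and \<open>\<infinity>\<close> if there is none.\<close>

definition graph_dist :: "'a pair_pre_digraph \<Rightarrow> 'a \<Rightarrow> 'a \<Rightarrow> ereal" where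
  "graph_dist H u v = wf_digraph.\<mu> (with_proj H) (\<lambda>_. 1) u v"

definition k_connected :: "nat \<Rightarrow> 'a pair_pre_digraph \<Rightarrow> bool" where
  "k_connected k G \<longleftrightarrow> card (pverts G) > k \<and>
     (\<forall>X \<subseteq> pverts G. card X < k \<longrightarrow> Digraph_Component.connected (with_proj G \<restriction> (pverts G - X)))"

text \<open>In a symmetric digraph, traversing an edge back and forth counts as a \<^const>\<open>pre_digraph.cycle\<close>;
  the length bound excludes it. The tails of the arcs of a cycle are exactly its vertices.\<close>

definition hamiltonian :: "'a pair_pre_digraph \<Rightarrow> bool" where
  "hamiltonian G \<longleftrightarrow>
     (\<exists>p. pre_digraph.cycle (with_proj G) p \<and> length p \<ge> 3 \<and> fst ` set p = pverts G)"

definition claw :: "'a pair_pre_digraph \<Rightarrow> bool" where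
  "claw H \<longleftrightarrow> K\<^bsub>1,3\<^esub> (with_proj H)"

text \<open>Only meaningful for claws, whose center is the vertex of degree 3.\<close>

definition claw_ends :: "'a pair_pre_digraph \<Rightarrow> 'a set" where
  "claw_ends H = {x \<in> pverts H. degree H x \<noteq> 3}"

definition o_heavy :: "'a pair_pre_digraph \<Rightarrow> bool" where
  "o_heavy G \<longleftrightarrow>
     (\<forall>H :: 'a pair_pre_digraph. induced_subgraph (with_proj H) (with_proj G) \<and> claw H \<longrightarrow>
        (\<exists>x \<in> claw_ends H. \<exists>y \<in> claw_ends H.
           x \<noteq> y \<and> degree G x + degree G y \<ge> card (pverts G)))"

datatype Z2_vert = A1 | A2 | A3 | B1 | C1

definition Z2 :: "Z2_vert pair_pre_digraph" where
  "Z2 = \<lparr> pverts = {A1, A2, A3, B1, C1},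
          parcs = {(A1, A2), (A1, A3), (A2, A3), (A1, B1), (B1, C1)}\<^sup>s \<rparr>"

end

theory Submission
  imports Defs
begin

text \<open>Call two vertices o-adjacent if they are adjacent or their degrees sum to at least \<open>n\<close>, and
  heavy if their degree is at least \<open>n / 2\<close>. Among the o-cycles through all heavy vertices take one,
  \<open>C\<close>, of maximal length and then with the fewest non-edges; Ore's crossing argument shows that it is
  a genuine cycle, and no o-cycle covers a proper superset of its vertices. Suppose that \<open>G - C\<close> has
  a component \<open>R\<close>. For a neighbour \<open>x \<in> C\<close> of \<open>R\<close> the claw at \<open>x\<close> makes \<open>x\<^sup>-\<close> and \<open>x\<^sup>+\<close> o-adjacent.

  If \<open>r \<in> R\<close> has two adjacent neighbours \<open>x, y \<in> C\<close>, walk along \<open>C\<close> from \<open>y\<close>. As long as only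
  neighbours of \<open>y\<close> that are not heavy have been met, the next vertex \<open>w\<close> is again a neighbour
  of \<open>y\<close>, for otherwise \<open>y, r, x\<close> and the last two vertices of the walk induce a \<open>Z\<^sub>2\<close> in which \<open>r\<close>
  and the neighbour of \<open>y\<close> violate the hypothesis. Hence a heavy vertex \<open>p\<close> is met; likewise a
  heavy \<open>q\<close> starting from \<open>x\<close>. Since \<open>p\<close> and \<open>q\<close> are o-adjacent, \<open>C\<close> can be rerouted through \<open>x, r, y\<close>.

  Otherwise every \<open>x\<close> has \<open>d(x\<^sup>-) + d(x\<^sup>+) \<ge> n\<close>: if \<open>x\<^sup>-\<close> and \<open>x\<^sup>+\<close> are adjacent, they form a \<open>Z\<^sub>2\<close> with \<open>x\<close>
  and a path of length 2 into \<open>R\<close>, and both are heavy. For two such vertices \<open>x, y\<close> neither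
  \<open>x\<^sup>+, y\<^sup>+\<close> nor \<open>x\<^sup>-, y\<^sup>-\<close> are o-adjacent, and adding up the degrees gives a contradiction.\<close>

section \<open>Extremal cycles\<close>

locale finite_graph =
  fixes V :: "'a set" and E :: "'a \<Rightarrow> 'a \<Rightarrow> bool"
  assumes fin: "finite V"
    and E_sym: "E a b \<Longrightarrow> E b a"
    and E_irrefl: "\<not> E a a"
    and E_V: "E a b \<Longrightarrow> a \<in> V"
begin

definition dg :: "'a \<Rightarrow> nat" where
  "dg v = card {w. E v w}"

definition oadj :: "'a \<Rightarrow> 'a \<Rightarrow> bool" where
  "oadj a b \<longleftrightarrow> a \<in> V \<and> b \<in> V \<and> a \<noteq> b \<and> (E a b \<or> card V \<le> dg a + dg b)"

definition heavy :: "'a \<Rightarrow> bool" where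
  "heavy v \<longleftrightarrow> v \<in> V \<and> card V \<le> 2 * dg v"

definition ocyc :: "'a list \<Rightarrow> bool" where
  "ocyc xs \<longleftrightarrow> 3 \<le> length xs \<and> distinct xs \<and> successively oadj xs \<and> oadj (last xs) (hd xs)"

text \<open>Lists are read cyclically. Rotating an extremal cycle to \<open>x # L\<close> makes \<open>hd L\<close> and \<open>last L\<close> the
  successor and the predecessor of \<open>x\<close>.\<close>

definition extremal :: "'a list \<Rightarrow> bool" where
  "extremal C \<longleftrightarrow> ocyc C \<and> successively E C \<and> E (last C) (hd C) \<and> (\<forall>v. heavy v \<longrightarrow> v \<in> set C) \<and>
     (\<forall>ys. ocyc ys \<longrightarrow> set C \<subseteq> set ys \<longrightarrow> set ys \<subseteq> set C)"

lemma E_comm: "E a b \<longleftrightarrow> E b a"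
  using E_sym by blast

lemma E_V2: "E a b \<Longrightarrow> b \<in> V"
  using E_sym E_V by blast

lemma oadj_comm: "oadj a b \<longleftrightarrow> oadj b a"
  by (auto simp: oadj_def E_comm add.commute)

lemma oadj_E: "E a b \<Longrightarrow> oadj a b"
  using E_V E_V2 E_irrefl by (auto simp: oadj_def)

lemma oadj_V: "oadj a b \<Longrightarrow> a \<in> V \<and> b \<in> V"
  by (auto simp: oadj_def)

lemma oadj_heavy: "heavy a \<Longrightarrow> heavy b \<Longrightarrow> a \<noteq> b \<Longrightarrow> oadj a b"
  by (auto simp: oadj_def heavy_def)

lemma successively_rev_oadj: "successively oadj (rev xs) \<longleftrightarrow> successively oadj xs"
  using oadj_comm by (auto intro: successively_mono)

lemma successively_rev_E: "successively E (rev xs) \<longleftrightarrow> successively E xs"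
  using E_comm by (auto intro: successively_mono)

lemmas cyc_simps = successively_append_iff successively_Cons successively_rev_oadj successively_rev_E
  hd_append last_append hd_rev last_rev

lemma ocyc_subset: assumes "ocyc xs" shows "set xs \<subseteq> V"
proof
  fix x assume "x \<in> set xs"
  then obtain as bs where xs: "xs = as @ x # bs" by (meson split_list)
  show "x \<in> V"
    using assms unfolding ocyc_def xs by (cases bs; cases as) (auto simp: cyc_simps dest: oadj_V)
qed

lemma extremal_ocyc: "extremal C \<Longrightarrow> ocyc C"
  by (simp add: extremal_def)

section \<open>Symmetries of extremal cycles: rotation and reversal\<close>

lemma extremal_rotate: assumes "extremal (as @ bs)" shows "extremal (bs @ as)"
proof -
  have "ocyc (bs @ as)"
    using assms unfolding extremal_def ocyc_def by (cases "as = []"; cases "bs = []") (auto simp: cyc_simps)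
  moreover have "successively E (bs @ as) \<and> E (last (bs @ as)) (hd (bs @ as))"
    using assms unfolding extremal_def by (cases "as = []"; cases "bs = []") (auto simp: cyc_simps)
  ultimately show ?thesis
    using assms unfolding extremal_def by (simp add: Un_commute)
qed

lemma extremal_rev: assumes "extremal xs" shows "extremal (rev xs)"
proof -
  have "xs \<noteq> []" using assms by (auto simp: extremal_def ocyc_def)
  then show ?thesis
    using assms unfolding extremal_def ocyc_def by (auto simp: cyc_simps oadj_comm E_comm)
qed

text \<open>Reversal exchanges successor and predecessor of \<open>x\<close>, so every statement
  about \<open>hd L\<close> yields its mirror image about \<open>last L\<close>.\<close>

lemma extremal_rev1: assumes "extremal (x # L)" shows "extremal (x # rev L)"
  using extremal_rotate[of "rev L" "[x]"] extremal_rev[OF assms] by simp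

lemma extremal_rev2: assumes "extremal (x # S @ y # T)" shows "extremal (x # rev T @ y # rev S)"
  using extremal_rev1[OF assms] by simp

lemma extremal_swap: assumes "extremal (x # S @ y # T)" shows "extremal (y # T @ x # S)"
  using extremal_rotate[of "x # S" "y # T"] assms by simp

lemma extremal_maximal: "extremal C \<Longrightarrow> ocyc ys \<Longrightarrow> set C \<subseteq> set ys \<Longrightarrow> z \<in> set ys \<Longrightarrow> z \<in> set C"
  by (auto simp: extremal_def)

lemma extremal_split: assumes "extremal C" "x \<in> set C" obtains L where "extremal (x # L)" "set (x # L) = set C"
proof -
  obtain as bs where "C = as @ x # bs" using assms(2) by (meson split_list)
  then show ?thesis using extremal_rotate[of as "x # bs"] assms(1) that[of "bs @ as"] by auto
qed

lemma extremal_distinct: "extremal L \<Longrightarrow> distinct L"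
  by (simp add: extremal_def ocyc_def)

lemma extremal_len: assumes "extremal (x # L)" shows "2 \<le> length L \<and> L \<noteq> [] \<and> last L \<noteq> hd L"
proof -
  have "2 \<le> length L" "distinct L"
    using assms by (simp_all add: extremal_def ocyc_def)
  then show ?thesis by (cases L) auto
qed

lemma extremal_E: assumes "extremal (x # L)" shows "E x (hd L) \<and> E x (last L)"
proof -
  have "successively E (x # L)" "E (last (x # L)) x" "L \<noteq> []"
    using assms extremal_len[OF assms] by (simp_all add: extremal_def)
  then show ?thesis using E_comm by (simp add: successively_Cons)
qed

text \<open>Otherwise \<open>Q\<close> could be inserted between \<open>x\<close> and its successor,
  giving an o-cycle that covers strictly more than the extremal one.\<close>

lemma not_insert_path:
  assumes g: "extremal (x # L)" and Q: "distinct Q" "successively oadj Q" "Q \<noteq> []"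
    "set Q \<inter> set (x # L) = {}" and x: "oadj x (hd Q)"
  shows "\<not> oadj (last Q) (hd L)"
proof
  assume "oadj (last Q) (hd L)"
  then have "ocyc (x # Q @ L)"
    using assms extremal_len[OF g] unfolding extremal_def ocyc_def by (auto simp: cyc_simps)
  moreover have "hd Q \<in> set Q" using Q by simp
  ultimately show False using extremal_maximal[OF g, of "x # Q @ L" "hd Q"] Q(4) by auto
qed

lemma not_insert: assumes "extremal (x # L)" "r \<notin> set (x # L)" "oadj x r" shows "\<not> oadj r (hd L)"
  using not_insert_path[OF assms(1), of "[r]"] assms by auto

lemma not_insert_last: assumes "extremal (x # L)" "r \<notin> set (x # L)" "oadj x r" shows "\<not> oadj r (last L)"
  using not_insert[OF extremal_rev1[OF assms(1)], of r] assms by (simp add: hd_rev)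

text \<open>An o-edge between the two successors would give the larger o-cycle \<open>x\<close>,
  \<open>Q\<close>, \<open>y\<close>, \<open>S\<close> backwards, \<open>T\<close>. An empty
  \<open>S\<close> or \<open>T\<close> would make \<open>x\<close> and \<open>y\<close> consecutive,
  so that \<open>Q\<close> could be inserted between them.\<close>

lemma two_attachments:
  assumes g: "extremal (x # S @ y # T)" and Q: "distinct Q" "successively oadj Q" "Q \<noteq> []"
    "set Q \<inter> set (x # S @ y # T) = {}" and x: "oadj x (hd Q)" and y: "oadj (last Q) y"
  shows "S \<noteq> [] \<and> T \<noteq> [] \<and> \<not> oadj (hd S) (hd T)"
proof -
  have S: "S \<noteq> []" using not_insert_path[OF g] Q x y by auto
  have T: "T \<noteq> []"
    using not_insert_path[OF extremal_rev1[OF g], of Q] Q x y by auto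
  have "\<not> oadj (hd S) (hd T)"
  proof
    assume "oadj (hd S) (hd T)"
    then have "ocyc (x # Q @ y # rev S @ T)"
      using g S T Q x y unfolding extremal_def ocyc_def by (auto simp: cyc_simps oadj_comm)
    moreover have "hd Q \<in> set Q" using Q by simp
  ultimately show False using extremal_maximal[OF g, of "x # Q @ y # rev S @ T" "hd Q"] Q(4) by auto
  qed
  with S T show ?thesis by blast
qed

lemma two_attachments_last:
  assumes g: "extremal (x # S @ y # T)" and Q: "distinct Q" "successively oadj Q" "Q \<noteq> []"
    "set Q \<inter> set (x # S @ y # T) = {}" and x: "oadj x (hd Q)" and y: "oadj (last Q) y"
  shows "\<not> oadj (last S) (last T)"
  using two_attachments[OF extremal_rev2[OF g] Q(1-3)] Q(4) x y oadj_comm by (auto simp: hd_rev)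

subsection \<open>Existence of extremal cycles\<close>

text \<open>The number of consecutive pairs that are not edges; applied to \<open>last C # C\<close> it also counts the
  closing pair.\<close>

primrec gaps :: "'a list \<Rightarrow> nat" where
  "gaps [] = 0"
| "gaps (x # xs) = (if xs = [] \<or> E x (hd xs) then 0 else 1) + gaps xs"

lemma gaps_append:
  "gaps (xs @ ys) = gaps xs + gaps ys + (if xs = [] \<or> ys = [] \<or> E (last xs) (hd ys) then 0 else 1)"
  by (induction xs) auto

lemma gaps_rev: "gaps (rev xs) = gaps xs"
  by (induction xs) (auto simp: gaps_append last_rev E_comm)

lemma ex_gap: "\<not> successively E xs \<Longrightarrow>
  \<exists>as bs. xs = as @ bs \<and> as \<noteq> [] \<and> bs \<noteq> [] \<and> \<not> E (last as) (hd bs)"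
proof (induction xs)
  case (Cons x xs)
  show ?case
  proof (cases "successively E xs")
    case True
    then show ?thesis using Cons.prems by (intro exI[of _ "[x]"] exI[of _ xs]) (auto simp: successively_Cons)
  next
    case False
    then obtain as bs where "xs = as @ bs" "as \<noteq> []" "bs \<noteq> []" "\<not> E (last as) (hd bs)"
      using Cons.IH by blast
    then show ?thesis by (intro exI[of _ "x # as"] exI[of _ bs]) auto
  qed
qed simp

lemma ocyc_rotate: "ocyc (as @ bs) \<Longrightarrow> ocyc (bs @ as)"
  unfolding ocyc_def by (cases "as = []"; cases "bs = []") (auto simp: cyc_simps)

lemma finite_nbrs: "finite {w. E v w}"
  using fin by (rule rev_finite_subset) (auto dest: E_V2)

text \<open>By counting. If no cut point existed, the neighbours of the two ends on \<open>D\<close>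
  would number at most \<open>k - 1\<close> altogether, where \<open>k\<close> is the length of
  \<open>D\<close>. By \<open>out\<close> the neighbours off \<open>D\<close> are distinct, at most
  \<open>card V - k\<close>. The degree sum would then be below \<open>card V\<close>.\<close>

lemma ore_crossing:
  assumes D: "distinct D" "set D \<subseteq> V" "D \<noteq> []" and n: "\<not> E (last D) (hd D)"
    and d: "card V \<le> dg (hd D) + dg (last D)"
    and out: "\<And>w. E (hd D) w \<Longrightarrow> E (last D) w \<Longrightarrow> w \<in> set D"
  shows "\<exists>as bs. D = as @ bs \<and> as \<noteq> [] \<and> bs \<noteq> [] \<and> E (hd D) (hd bs) \<and> E (last D) (last as)"
proof -
  define u v k where "u = hd D" and "v = last D" and "k = length D"
  \<comment> \<open>An index \<open>i\<close> stands for the consecutive pair \<open>D ! i\<close>,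
    \<open>D ! Suc i\<close>. A common element of \<open>I\<close> and \<open>J\<close> is a place
    to cut.\<close>
  define I where "I = {i. Suc i < k \<and> E u (D ! Suc i)}"
  define J where "J = {i. Suc i < k \<and> E v (D ! i)}"
  have k: "k > 0" "u = D ! 0" "v = D ! (k - 1)"
    using D(3) by (simp_all add: u_def v_def k_def hd_conv_nth last_conv_nth)
  have fIJ: "finite I" "finite J"
    unfolding I_def J_def by (auto intro: finite_subset[of _ "{..<k}"])
  have "I \<inter> J \<noteq> {}"
  proof
    assume IJ: "I \<inter> J = {}"
    have "I \<union> J \<subseteq> {..<k - 1}" unfolding I_def J_def by auto
    then have c1: "card I + card J \<le> k - 1"
      using card_mono[of "{..<k - 1}" "I \<union> J"] card_Un_disjoint[OF fIJ IJ] by simp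
    have "{w. E u w} \<subseteq> (\<lambda>i. D ! Suc i) ` I \<union> ({w. E u w} - set D)"
    proof
      fix w assume w: "w \<in> {w. E u w}"
      show "w \<in> (\<lambda>i. D ! Suc i) ` I \<union> ({w. E u w} - set D)"
      proof (cases "w \<in> set D")
        case True
        then obtain j where j: "j < k" "D ! j = w" unfolding k_def by (meson in_set_conv_nth)
        then have "j \<noteq> 0" using w E_irrefl k(2) by (metis mem_Collect_eq)
        then obtain i where "j = Suc i" using not0_implies_Suc by blast
        then show ?thesis using j w unfolding I_def by auto
      qed (use w in auto)
    qed
    then have "card {w. E u w} \<le> card ((\<lambda>i. D ! Suc i) ` I \<union> ({w. E u w} - set D))"
      by (rule card_mono[rotated]) (use fIJ finite_nbrs in auto)
    also have "\<dots> \<le> card I + card ({w. E u w} - set D)"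
      using card_Un_le card_image_le[OF fIJ(1)] by (meson add_mono le_trans order_refl)
    finally have c2: "dg u \<le> card I + card ({w. E u w} - set D)" unfolding dg_def .
    have "{w. E v w} \<subseteq> (\<lambda>i. D ! i) ` J \<union> ({w. E v w} - set D)"
    proof
      fix w assume w: "w \<in> {w. E v w}"
      show "w \<in> (\<lambda>i. D ! i) ` J \<union> ({w. E v w} - set D)"
      proof (cases "w \<in> set D")
        case True
        then obtain j where j: "j < k" "D ! j = w" unfolding k_def by (meson in_set_conv_nth)
        then have "j \<noteq> k - 1" using w E_irrefl k(3) by (metis mem_Collect_eq)
        then show ?thesis using j w unfolding J_def by auto
      qed (use w in auto)
    qed
    then have "card {w. E v w} \<le> card ((\<lambda>i. D ! i) ` J \<union> ({w. E v w} - set D))"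
      by (rule card_mono[rotated]) (use fIJ finite_nbrs in auto)
    also have "\<dots> \<le> card J + card ({w. E v w} - set D)"
      using card_Un_le card_image_le[OF fIJ(2)] by (meson add_mono le_trans order_refl)
    finally have c3: "dg v \<le> card J + card ({w. E v w} - set D)" unfolding dg_def .
    have "card ({w. E u w} - set D) + card ({w. E v w} - set D)
        = card (({w. E u w} - set D) \<union> ({w. E v w} - set D))"
      using finite_nbrs out unfolding u_def v_def by (intro card_Un_disjoint[symmetric]) auto
    also have "\<dots> \<le> card (V - set D)"
      using fin by (intro card_mono) (auto dest: E_V2)
    also have "\<dots> = card V - k"
      using D by (simp add: card_Diff_subset distinct_card k_def)
    finally have c4: "card ({w. E u w} - set D) + card ({w. E v w} - set D) \<le> card V - k" .
    have "k \<le> card V" using D fin card_mono[of V "set D"] distinct_card[of D] k_def by simp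
    then show False using c1 c2 c3 c4 d k(1) unfolding u_def v_def by linarith
  qed
  then obtain i where i: "Suc i < k" "E u (D ! Suc i)" "E v (D ! i)" unfolding I_def J_def by auto
  have "last (take (Suc i) D) = D ! i" "hd (drop (Suc i) D) = D ! Suc i"
    using i(1) by (simp_all add: k_def hd_drop_conv_nth take_Suc_conv_app_nth)
  then show ?thesis
    using i D(3) unfolding u_def v_def k_def
    by (intro exI[of _ "take (Suc i) D"] exI[of _ "drop (Suc i) D"]) auto
qed

lemma ex_extremal_from:
  assumes C0: "ocyc C0" "\<And>v. heavy v \<Longrightarrow> v \<in> set C0"
  shows "\<exists>C. extremal C"
proof -
  define P where "P C \<longleftrightarrow> ocyc C \<and> (\<forall>v. heavy v \<longrightarrow> v \<in> set C)" for C
  have "\<exists>C. P C \<and> (\<forall>D. P D \<longrightarrow> length D \<le> length C)"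
  proof (rule ex_has_greatest_nat)
    show "P C0" using C0 by (simp add: P_def)
    show "\<forall>D. P D \<longrightarrow> length D < Suc (card V)"
    proof (intro allI impI)
      fix D assume "P D"
      then have "set D \<subseteq> V" "distinct D" using ocyc_subset by (auto simp: P_def ocyc_def)
      then show "length D < Suc (card V)"
        using card_mono[OF fin, of "set D"] distinct_card[of D] by simp
    qed
  qed
  then obtain C1 where C1: "P C1" "\<And>D. P D \<Longrightarrow> length D \<le> length C1" by blast
  define P' where "P' C \<longleftrightarrow> P C \<and> length C = length C1" for C
  define f where "f C = gaps (last C # C)" for C
  have "\<exists>C. P' C \<and> (\<forall>D. P' D \<longrightarrow> f C \<le> f D)"
    by (rule ex_has_least_nat[of P' C1]) (simp add: P'_def C1)
  then obtain C where C: "P' C" "\<And>D. P' D \<Longrightarrow> f C \<le> f D" by blast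
  have ocC: "ocyc C" and lenC: "length C = length C1" and PC: "P C"
    using C(1) by (simp_all add: P'_def P_def)
  have real: "successively E C \<and> E (last C) (hd C)"
  proof (rule ccontr)
    assume n: "\<not> ?thesis"
    \<comment> \<open>Rotating moves a non-edge to the closing position, where
      \<open>ore_crossing\<close> applies, and keeps \<open>f\<close>.\<close>
    have "\<exists>D. P' D \<and> f D = f C \<and> \<not> E (last D) (hd D)"
    proof (cases "successively E C")
      case True
      then show ?thesis using n C(1) by blast
    next
      case False
      then obtain as bs where ab: "C = as @ bs" "as \<noteq> []" "bs \<noteq> []" "\<not> E (last as) (hd bs)"
        using ex_gap by blast
      have "P' (bs @ as)"
        using C(1) ocyc_rotate unfolding P'_def P_def ab(1) by auto
      moreover have "f (bs @ as) = f C"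
        unfolding f_def ab(1) using ab(2,3) by (simp add: gaps_append)
      ultimately show ?thesis using ab by auto
    qed
    then obtain D where D: "P' D" "f D = f C" "\<not> E (last D) (hd D)" by blast
    have oc: "ocyc D" and PD: "P D" and lenD: "length D = length C1"
      using D(1) unfolding P'_def P_def by auto
    have D0: "D \<noteq> []" "distinct D" using oc by (auto simp: ocyc_def)
    have "oadj (last D) (hd D)" using oc by (simp add: ocyc_def)
    then have sum: "card V \<le> dg (hd D) + dg (last D)" using D(3) by (auto simp: oadj_def)
    \<comment> \<open>A common neighbour off \<open>D\<close> would fit into the closing gap and
      give a longer o-cycle.\<close>
    have out: "w \<in> set D" if w: "E (hd D) w" "E (last D) w" for w
    proof (rule ccontr)
      assume "w \<notin> set D"
      then have "ocyc (w # D)"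
        using oc oadj_E[OF w(1)] oadj_E[OF w(2)] D0 unfolding ocyc_def
        by (auto simp: cyc_simps oadj_comm)
      then have "P (w # D)" using PD by (simp add: P_def)
      then show False using C1(2) lenD by fastforce
    qed
    obtain as bs where ab: "D = as @ bs" "as \<noteq> []" "bs \<noteq> []" "E (hd D) (hd bs)" "E (last D) (last as)"
      using ore_crossing[OF D0(2) ocyc_subset[OF oc] D0(1) D(3) sum out] by blast
    have "ocyc (as @ rev bs)"
      using oc ab oadj_E[OF ab(4)] oadj_E[OF ab(5)] unfolding ocyc_def ab(1)
      by (auto simp: cyc_simps oadj_comm)
    then have "P' (as @ rev bs)" using D(1) unfolding P'_def P_def ab(1) by auto
    \<comment> \<open>Both new junctions are edges, while one of the two removed pairs, the closing
      one, was a non-edge.\<close>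
    moreover have "f (as @ rev bs) < f D"
      using ab D(3) unfolding f_def ab(1)
      by (auto simp: gaps_append gaps_rev hd_rev last_rev E_comm)
    ultimately show False using C(2) D(2) by fastforce
  qed
  have "extremal C"
    unfolding extremal_def
  proof (intro conjI allI impI)
    fix ys assume ys: "ocyc ys" "set C \<subseteq> set ys"
    then have "P ys" using PC unfolding P_def by auto
    then have "card (set ys) \<le> card (set C)"
      using C1(2) ys ocC lenC distinct_card unfolding ocyc_def by metis
    then show "set ys \<subseteq> set C" using card_seteq[OF _ ys(2)] by auto
  qed (use PC real in \<open>auto simp: P_def\<close>)
  then show ?thesis by blast
qed

section \<open>Walks and o-paths inside a vertex set\<close>

definition walk_in :: "'a set \<Rightarrow> ('a \<times> 'a) set" where
  "walk_in X = {(a, b). E a b \<and> a \<in> X \<and> b \<in> X}"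

text \<open>Built backwards from \<open>b\<close>. When the new first vertex already lies on the
  path, the loop in front of its occurrence is cut off.\<close>

lemma path_in:
  assumes "(a, b) \<in> (walk_in X)\<^sup>*" "b \<in> X"
  shows "\<exists>Q. distinct Q \<and> successively oadj Q \<and> Q \<noteq> [] \<and> hd Q = a \<and> last Q = b \<and> set Q \<subseteq> X"
  using assms
proof (induction rule: converse_rtrancl_induct)
  case base
  then show ?case by (intro exI[of _ "[b]"]) auto
next
  case (step a c)
  then obtain Q where Q: "distinct Q" "successively oadj Q" "Q \<noteq> []" "hd Q = c" "last Q = b" "set Q \<subseteq> X"
    by blast
  have ac: "E a c" "a \<in> X" using step.hyps(1) by (auto simp: walk_in_def)
  show ?case
  proof (cases "a \<in> set Q")
    case True
    then obtain as bs where "Q = as @ a # bs" by (meson split_list)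
    then show ?thesis using Q by (intro exI[of _ "a # bs"]) (auto simp: cyc_simps)
  next
    case False
    then show ?thesis using Q ac oadj_E by (intro exI[of _ "a # Q"]) (auto simp: cyc_simps)
  qed
qed

lemma walk_in_sym: "(a, b) \<in> (walk_in X)\<^sup>* \<Longrightarrow> (b, a) \<in> (walk_in X)\<^sup>*"
  by (rule symD[OF sym_rtrancl]) (auto simp: sym_def walk_in_def E_comm)

lemma walk_in_closed: "(a, b) \<in> (walk_in X)\<^sup>* \<Longrightarrow> a \<in> X \<Longrightarrow> b \<in> X"
  by (induction rule: rtrancl_induct) (auto simp: walk_in_def)

end

section \<open>Neighbours of a vertex outside an extremal cycle\<close>

locale o_heavy_Z2_graph = finite_graph +
  assumes claw_heavy: "\<lbrakk> E c a; E c b; E c d; distinct [a, b, d]; \<not> E a b; \<not> E a d; \<not> E b d \<rbrakk>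
      \<Longrightarrow> oadj a b \<or> oadj a d \<or> oadj b d"
    \<comment> \<open>Since \<open>a1\<close> is a common neighbour of \<open>a2\<close> and \<open>b\<close>, the last disjunct says that there are two.\<close>
    and Z2_heavy: "\<lbrakk> distinct [a1, a2, a3, b, c]; E a1 a2; E a1 a3; E a2 a3; E a1 b; E b c;
      \<not> E a2 b; \<not> E a3 b; \<not> E a1 c; \<not> E a2 c; \<not> E a3 c \<rbrakk>
      \<Longrightarrow> heavy a2 \<or> heavy b \<or> (\<exists>z. z \<noteq> a1 \<and> E a2 z \<and> E b z)"
begin

text \<open>The vertices \<open>r\<close>, \<open>hd L\<close>, \<open>last L\<close> are candidates
  for the ends of a claw at \<open>x\<close>. Since \<open>r\<close> cannot be inserted next to
  \<open>x\<close>, it is o-adjacent to neither of the others, so only the pair \<open>hd L\<close>,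
  \<open>last L\<close> remains.\<close>

lemma bypass: assumes g: "extremal (x # L)" and r: "r \<notin> set (x # L)" "E x r"
  shows "oadj (last L) (hd L)"
proof (rule ccontr)
  assume n: "\<not> oadj (last L) (hd L)"
  have "\<not> oadj r (hd L)" "\<not> oadj r (last L)"
    using not_insert[OF g r(1)] not_insert_last[OF g r(1)] oadj_E[OF r(2)] by auto
  moreover from this have "r \<noteq> hd L" "r \<noteq> last L"
    using r extremal_len[OF g] by auto
  moreover have "\<not> oadj (hd L) (last L)" using n oadj_comm by blast
  ultimately show False
    using claw_heavy[of x r "hd L" "last L"] r(2) extremal_E[OF g] extremal_len[OF g]
      oadj_E[of r "hd L"] oadj_E[of r "last L"] oadj_E[of "hd L" "last L"]
    by (metis distinct_length_2_or_more distinct_singleton)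
qed

text \<open>By \<open>bypass\<close> at \<open>z\<close>, the cycle can skip \<open>z\<close>. The
  path \<open>r, z\<close> would then fit between \<open>x\<close> and \<open>hd L\<close>.\<close>

lemma not_second_attachment:
  assumes g: "extremal (x # L)" and r: "r \<notin> set (x # L)" "E x r" and z: "E r z" "z \<in> set L"
  shows "\<not> oadj z (hd L)"
proof
  assume zh: "oadj z (hd L)"
  obtain S T where L: "L = S @ z # T" using z(2) by (meson split_list)
  have ST: "S \<noteq> []" "T \<noteq> []"
    using two_attachments[OF g[unfolded L], of "[r]"] r z L oadj_E by auto
  have "oadj (last S) (hd T)"
    using bypass[OF extremal_swap[OF g[unfolded L]], of r] r z E_comm ST unfolding L
    by (auto simp: oadj_comm)
  then have "ocyc (x # r # z # S @ T)"
    using g zh ST r oadj_E[OF z(1)] oadj_E[OF r(2)] unfolding extremal_def ocyc_def L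
    by (auto simp: cyc_simps oadj_comm)
  then show False using extremal_maximal[OF g, of "x # r # z # S @ T" r] r unfolding L by auto
qed

text \<open>On the cycle, another common neighbour is excluded by
  \<open>not_second_attachment\<close>. Off the cycle, the path \<open>r, z\<close> could be
  inserted after \<open>x\<close>.\<close>

lemma common_nbr:
  assumes g: "extremal (x # L)" and r: "r \<notin> set (x # L)" "E x r" and z: "E r z" "E z (hd L)"
  shows "z = x"
proof (rule ccontr)
  assume "z \<noteq> x"
  show False
  proof (cases "z \<in> set L")
    case True
    then show False using not_second_attachment[OF g r z(1)] oadj_E[OF z(2)] by blast
  next
    case False
    then show False
      using not_insert_path[OF g, of "[r, z]"] r z \<open>z \<noteq> x\<close> oadj_E E_irrefl by (auto simp: cyc_simps)
  qed
qed

lemma common_nbr_last: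
  assumes g: "extremal (x # L)" and r: "r \<notin> set (x # L)" "E x r" and z: "E r z" "E z (last L)"
  shows "z = x"
  using common_nbr[OF extremal_rev1[OF g], of r z] assms by (simp add: hd_rev)

text \<open>The triangle \<open>x, hd L, last L\<close> and the path \<open>x, r, s\<close> form an
  induced \<open>Z2\<close>, whether or not \<open>s\<close> is on the cycle. In the pair
  \<open>hd L, r\<close>, the vertex \<open>r\<close> is off the cycle and so not heavy, and
  \<open>x\<close> is the only common neighbour.\<close>

lemma nbr_heavy:
  assumes g: "extremal (x # L)" and r: "r \<notin> set (x # L)" "E x r" and e: "E (last L) (hd L)"
    and s: "E r s" "s \<noteq> x" "\<not> E x s"
  shows "heavy (hd L)"
proof -
  have n: "\<not> E r (hd L)" "\<not> E r (last L)"
    using not_insert[OF g r(1)] not_insert_last[OF g r(1)] r(2) oadj_E by blast+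
  have n2: "\<not> E s (hd L)" "\<not> E s (last L)"
    using common_nbr[OF g r s(1)] common_nbr_last[OF g r s(1)] s(2) by auto
  have "heavy (hd L) \<or> heavy r \<or> (\<exists>z. z \<noteq> x \<and> E (hd L) z \<and> E r z)"
    using extremal_len[OF g] extremal_E[OF g] r s e n n2 extremal_distinct[OF g]
    by (intro Z2_heavy[of x "hd L" "last L" r s]) (auto simp: E_comm E_irrefl)
  moreover have "\<not> heavy r" using g r(1) unfolding extremal_def by auto
  ultimately show ?thesis using common_nbr[OF g r] E_comm by blast
qed

lemma nbrs_sum:
  assumes g: "extremal (x # L)" and r: "r \<notin> set (x # L)" "E x r" 
    and s: "E r s" "s \<noteq> x" "\<not> E x s"
  shows "card V \<le> dg (hd L) + dg (last L)"
proof (cases "E (last L) (hd L)")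
  case True
  have "heavy (hd L)" "heavy (last L)"
    using nbr_heavy[OF g r True s] nbr_heavy[OF extremal_rev1[OF g], of r s] r s True 
    by (auto simp: hd_rev last_rev E_comm)
  then show ?thesis by (simp add: heavy_def)
next
  case False
  then show ?thesis using bypass[OF g r] by (auto simp: oadj_def)
qed

section \<open>Two vertices of the cycle with a common neighbour outside\<close>

lemma extremal_pair:
  assumes g: "extremal (x # S @ y # T)" and r: "r \<notin> set (x # S @ y # T)" "E x r" "E y r"
  shows "S \<noteq> []" "T \<noteq> []" "oadj (last S) (hd T)" "oadj (last T) (hd S)"
    "E x (hd S)" "E x (last T)" "E y (last S)" "E y (hd T)"
proof -
  show S: "S \<noteq> []" and T: "T \<noteq> []"
    using two_attachments[OF g, of "[r]"] r oadj_E[OF r(2)] oadj_E[OF r(3)] by (auto simp: oadj_comm)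
  show "oadj (last S) (hd T)"
    using bypass[OF extremal_swap[OF g], of r] r S T by (auto simp: oadj_comm)
  show "oadj (last T) (hd S)"
    using bypass[OF g, of r] r S T by auto
  show "E x (hd S)" "E x (last T)" using extremal_E[OF g] S T by auto
  show "E y (last S)" "E y (hd T)" using extremal_E[OF extremal_swap[OF g]] S T by auto
qed

context
  fixes x y r :: 'a and S T :: "'a list"
  assumes g: "extremal (x # S @ y # T)" and r: "r \<notin> set (x # S @ y # T)" "E x r" "E y r"
begin

lemmas pair_facts = extremal_pair[OF g r]

text \<open>While all of \<open>T1\<close> is adjacent to \<open>y\<close>, the vertex \<open>y\<close> may be moved behind \<open>T1\<close>, its old
  neighbours \<open>last S\<close> and \<open>hd T\<close> being o-adjacent; likewise \<open>x\<close> may be dropped from its place.\<close>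

lemma run_facts:
  assumes T: "T = T1 @ t # T2" "\<forall>u\<in>set T1. E y u"
  shows "successively oadj S" "successively oadj T1" "successively oadj (t # T2)"
    "distinct (x # S @ y # T1 @ t # T2)" "2 \<le> length S + length T"
    "oadj y r" "oadj x r" "oadj x (hd S)" "oadj x (last (t # T2))" "oadj y (last S)"
    "T1 \<noteq> [] \<Longrightarrow> oadj y (last T1)" "T1 \<noteq> [] \<Longrightarrow> oadj (last S) (hd T1)" 
    "T1 = [] \<Longrightarrow> oadj (last S) t" "oadj (last (t # T2)) (hd S)" "S \<noteq> []"
proof -
  have o: "ocyc (x # S @ y # T)" by (rule extremal_ocyc[OF g])
  show "successively oadj S" "successively oadj T1" "successively oadj (t # T2)"
    "distinct (x # S @ y # T1 @ t # T2)" 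
    using o T(1) unfolding ocyc_def by (auto simp: cyc_simps)
  show "2 \<le> length S + length T" using pair_facts(1,2) by (cases S; cases T) auto
  show "oadj y r" "oadj x r" "oadj x (hd S)" "oadj x (last (t # T2))" "oadj y (last S)" "S \<noteq> []"
    "oadj (last (t # T2)) (hd S)"
    using pair_facts r(2,3) oadj_E T(1) by auto
  show "T1 \<noteq> [] \<Longrightarrow> oadj y (last T1)" using T(2) oadj_E by auto
  show "T1 \<noteq> [] \<Longrightarrow> oadj (last S) (hd T1)"  "T1 = [] \<Longrightarrow> oadj (last S) t" using pair_facts(3) T(1) by auto
qed

text \<open>Otherwise \<open>y\<close> could be moved behind \<open>T1\<close> and \<open>r\<close>
  inserted between \<open>y\<close> and \<open>t\<close>.\<close>

lemma run_not_nbr: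
  assumes T: "T = T1 @ t # T2" "\<forall>u\<in>set T1. E y u" 
  shows "\<not> oadj r t"
proof
  assume "oadj r t"
  then have "ocyc (x # S @ T1 @ y # r # t # T2)"
    using run_facts[OF T] r(1) T(1) unfolding ocyc_def
    by (cases "T1 = []") (auto simp: cyc_simps oadj_comm)
  then show False using extremal_maximal[OF g, of "x # S @ T1 @ y # r # t # T2" r] r(1) T(1) by auto
qed

text \<open>Otherwise the path \<open>y, r, x\<close> would fit between \<open>T1\<close> and
  \<open>t\<close>. The gaps left by \<open>x\<close> and \<open>y\<close> are closed by o-edges
  between their former neighbours.\<close>

lemma run_not_nbr_x:
  assumes T: "T = T1 @ t # T2" "\<forall>u\<in>set T1. E y u" and xy: "E x y"
  shows "\<not> oadj x t"
proof
  assume "oadj x t"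
  then have "ocyc (S @ T1 @ y # r # x # t # T2)"
    using run_facts[OF T] r(1) T(1) unfolding ocyc_def
    by (cases "T1 = []") (auto simp: cyc_simps oadj_comm)
  then show False using extremal_maximal[OF g, of "S @ T1 @ y # r # x # t # T2" r] r(1) T(1) by auto
qed

text \<open>This excludes the common-neighbour alternative in \<open>run_extend\<close>. A second
  common neighbour \<open>z\<close> would allow the path \<open>y, r, z\<close> between
  \<open>T1\<close> and \<open>q\<close>. If \<open>z\<close> is on the cycle, it is first removed
  from its old place by \<open>bypass\<close>.\<close>

lemma run_common_nbr:
  assumes T: "T = T1 @ q # w # T2" "\<forall>u\<in>set (T1 @ [q]). E y u" and xy: "E x y"
    and z: "E r z" "E q z" "\<not> E r w"
  shows "z = y"
proof (rule ccontr)
  assume zy: "z \<noteq> y"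
  have T1: "\<forall>u\<in>set T1. E y u" and yq: "E y q" using T(2) by auto
  note F = run_facts[OF T(1) T1]
  have rz: "oadj r z" and qz: "oadj q z" using z oadj_E by auto
  have zr: "z \<noteq> r" using E_irrefl z(1) by auto
  have zx: "z \<noteq> x" using run_not_nbr_x[OF T(1) T1 xy] qz oadj_comm by auto
  have zq: "z \<noteq> q" using E_irrefl z(2) by auto
  have zw: "z \<noteq> w" using z by auto
  have zT1: "z \<notin> set T1"
  proof
    assume "z \<in> set T1"
    then obtain Ta Tb where "T1 = Ta @ z # Tb" by (meson split_list)
    then show False using run_not_nbr[of Ta z "Tb @ q # w # T2"] T rz by auto
  qed
  consider "z \<notin> set (x # S @ y # T)" | "z \<in> set S" | "z \<in> set T2"
    using zx zy zq zw zT1 unfolding T(1) by auto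
  then show False
  proof cases
    case 1
    have "ocyc (x # S @ T1 @ y # r # z # q # w # T2)"
      using F 1 r(1) rz qz zr T(1) unfolding ocyc_def
      by (cases "T1 = []") (auto simp: cyc_simps oadj_comm)
    then show False using extremal_maximal[OF g, of "x # S @ T1 @ y # r # z # q # w # T2" r] r(1) T(1) by auto
  next
    case 2
    then obtain Sa Sb where S: "S = Sa @ z # Sb" by (meson split_list)
    \<comment> \<open>All of \<open>x\<close>, \<open>z\<close>, \<open>y\<close> are neighbours of
      \<open>r\<close>, so no two of them are consecutive on the cycle.\<close>
    have g1: "extremal (x # Sa @ z # (Sb @ y # T))" using g S by simp
    have g2: "extremal (z # Sb @ y # (T @ x # Sa))" using extremal_swap[OF g1] by simp
    have Sa: "Sa \<noteq> []" using extremal_pair(1)[OF g1, of r] r z E_comm S by auto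
    have Sb: "Sb \<noteq> []" using extremal_pair(1)[OF g2, of r] r z E_comm S by auto
    have "oadj (last Sa) (hd Sb)"
      using extremal_pair(3)[OF g1, of r] r z E_comm S Sb by auto
    then have "ocyc (x # Sa @ Sb @ T1 @ y # r # z # q # w # T2)"
      using F r(1) rz qz zr T(1) Sa Sb unfolding ocyc_def S
      by (cases "T1 = []") (auto simp: cyc_simps oadj_comm)
    then show False 
      using extremal_maximal[OF g, of "x # Sa @ Sb @ T1 @ y # r # z # q # w # T2" r] r(1) T(1) S by auto
  next
    case 3
    then obtain Ta Tb where T2: "T2 = Ta @ z # Tb" by (meson split_list)
    have g1: "extremal (x # (S @ y # T1 @ q # w # Ta) @ z # Tb)" using g T(1) T2 by simp
    have Tb: "Tb \<noteq> []" using extremal_pair(2)[OF g1, of r] r z E_comm T(1) T2 by auto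
    have "oadj (last (w # Ta)) (hd Tb)"
      using extremal_pair(3)[OF g1, of r] r z E_comm T(1) T2 by auto
    then have "ocyc (x # S @ T1 @ y # r # z # q # w # Ta @ Tb)"
      using F r(1) rz qz zr T(1) Tb unfolding ocyc_def T2
      by (cases "T1 = []"; cases "Ta = []") (auto simp: cyc_simps oadj_comm)
    then show False 
      using extremal_maximal[OF g, of "x # S @ T1 @ y # r # z # q # w # Ta @ Tb" r] r(1) T(1) T2 by auto
  qed
qed

text \<open>If not, the triangle \<open>y, r, x\<close> with the path \<open>y, q, w\<close> is an
  induced \<open>Z2\<close>. Its pair \<open>r, q\<close> contains no heavy vertex and has only
  \<open>y\<close> as a common neighbour.\<close>

lemma run_extend:
  assumes T: "T = T1 @ q # w # T2" "\<forall>u\<in>set (T1 @ [q]). E y u" and xy: "E x y" and q: "\<not> heavy q"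
  shows "E y w"
proof (rule ccontr)
  assume yw: "\<not> E y w"
  have T1: "\<forall>u\<in>set T1. E y u" and yq: "E y q" using T(2) by auto
  have T': "T = (T1 @ [q]) @ w # T2" using T(1) by simp
  note F = run_facts[OF T(1) T1]
  have rq: "\<not> E r q" using run_not_nbr[OF T(1) T1] oadj_E by auto
  have rw: "\<not> E r w" using run_not_nbr[OF T' T(2)] oadj_E by auto
  have xq: "\<not> E x q" using run_not_nbr_x[OF T(1) T1 xy] oadj_E by auto
  have xw: "\<not> E x w" using run_not_nbr_x[OF T' T(2) xy] oadj_E by auto
  have "successively E (x # S @ y # T)" using g by (simp add: extremal_def)
  then have qw: "E q w" unfolding T(1) by (auto simp: cyc_simps)
  have "heavy r \<or> heavy q \<or> (\<exists>z. z \<noteq> y \<and> E r z \<and> E q z)"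
    using r xy yw yq rq rw xq xw qw F(4) T(1)
    by (intro Z2_heavy[of y r x q w]) (auto simp: E_comm)
  moreover have "\<not> heavy r" using g r(1) unfolding extremal_def by auto
  ultimately show False using run_common_nbr[OF T xy] rw q by blast
qed

lemma heavy_run:
  assumes xy: "E x y"
  shows "\<exists>T1 p T2. T = T1 @ p # T2 \<and> (\<forall>u\<in>set (T1 @ [p]). E y u) \<and> heavy p"
proof (rule ccontr)
  assume n: "\<not> ?thesis"
  have all: "T = T1 @ T2 \<Longrightarrow> \<forall>u\<in>set T1. E y u" for T1 T2
  proof (induction T1 arbitrary: T2 rule: rev_induct)
    case (snoc p T1)
    then have IH: "\<forall>u\<in>set T1. E y u" by simp
    have "E y p"
    proof (cases T1 rule: rev_cases)
      case Nil
      then show ?thesis using pair_facts(8) snoc.prems by simp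
    next
      case (snoc T0 q)
      then have T: "T = T0 @ q # p # T2" using snoc.prems by simp
      show ?thesis using run_extend[OF T _ xy] n T IH snoc by auto
    qed
    then show ?case using IH by simp
  qed simp
  \<comment> \<open>If the run never met a heavy vertex, it would cover all of \<open>T\<close>. But
    \<open>last T\<close> is adjacent to \<open>x\<close>, against
    \<open>run_not_nbr_x\<close>.\<close>
  have T: "T = butlast T @ last T # []" using pair_facts(2) by simp
  then show False
    using run_not_nbr_x[OF T _ xy] all[of "butlast T" "[last T]"] pair_facts(6) oadj_E by auto
qed

end

lemma no_triangle:
  assumes g: "extremal (x # S @ y # T)" and r: "r \<notin> set (x # S @ y # T)" "E x r" "E y r"
  shows "\<not> E x y"
proof
  assume xy: "E x y"
  obtain T1 p T2 where T: "T = T1 @ p # T2" "\<forall>u\<in>set (T1 @ [p]). E y u" "heavy p"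
    using heavy_run[OF g r xy] by blast
  have g': "extremal (y # T @ x # S)" and r': "r \<notin> set (y # T @ x # S)" and yx: "E y x"
    using extremal_swap[OF g] r(1) xy E_comm by auto
  obtain S1 q S2 where S: "S = S1 @ q # S2" "\<forall>u\<in>set (S1 @ [q]). E x u" "heavy q"
    using heavy_run[OF g' r' r(3,2) yx] by blast
  have T1: "\<forall>u\<in>set T1. E y u" and S1: "\<forall>u\<in>set S1. E x u" using T(2) S(2) by auto
  note F = run_facts[OF g r T(1) T1] run_facts[OF g' r' r(3,2) S(1) S1]
  have pq: "oadj p q" using oadj_heavy[OF T(3) S(3)] F(4) S(1) by auto
  \<comment> \<open>From \<open>y\<close> the route goes back through \<open>T1\<close>, jumps from
    \<open>hd T\<close> to \<open>last S\<close>, goes back to \<open>q\<close>, and takes the heavy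
    o-edge to \<open>p\<close>. If \<open>S1\<close> is nonempty, it closes from
    \<open>last T\<close> to \<open>hd S\<close>, skipping the old place of
    \<open>x\<close>.\<close>
  have "ocyc (S1 @ x # r # y # rev (q # S2 @ T1) @ p # T2)"
    using F pq r(1) S(1) T(1) unfolding ocyc_def
    by (cases "T1 = []"; cases "S1 = []"; cases "S2 = []") (auto simp: cyc_simps oadj_comm)
  then show False
    using extremal_maximal[OF g, of "S1 @ x # r # y # rev (q # S2 @ T1) @ p # T2" r] r(1) T(1) S(1) by auto
qed

end

section \<open>2-connectedness: extremal cycles exist and are spanning\<close>

locale two_connected_Z2_graph = o_heavy_Z2_graph +
  assumes card3: "3 \<le> card V"
    and no_cutvertex: "S \<subseteq> V - {u} \<Longrightarrow> S \<noteq> {} \<Longrightarrow> V - {u} - S \<noteq> {} \<Longrightarrow> \<exists>a\<in>S. \<exists>b\<in>V - {u} - S. E a b"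
begin

lemma ex_nbr: assumes "u \<in> V" "w \<noteq> u" shows "\<exists>b. b \<noteq> w \<and> E u b"
proof -
  have "card {u, w} < card V" using card3 assms(2) by simp
  then have "\<not> V \<subseteq> {u, w}" using card_mono[of "{u, w}" V] by auto
  then show ?thesis using no_cutvertex[of "{u}" w] assms by auto
qed

text \<open>\<open>u\<close> has a neighbour other than \<open>v\<close>. Deleting \<open>u\<close>
  leaves a path from that neighbour to \<open>v\<close>, which is closed up through
  \<open>u\<close>, using the o-edge once.\<close>

lemma cycle_through:
  assumes uv: "oadj u v" shows "\<exists>C. ocyc C \<and> u \<in> set C \<and> v \<in> set C"
proof -
  have V: "u \<in> V" "v \<in> V" "u \<noteq> v" using uv by (auto simp: oadj_def)
  obtain a where a: "a \<noteq> v" "E u a" using ex_nbr[OF V(1), of v] V(3) by blast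
  define X where "X = V - {u}"
  define S where "S = (walk_in X)\<^sup>* `` {a}"
  have aX: "a \<in> X" using a E_V2 E_irrefl unfolding X_def by blast
  have "v \<in> S"
  proof (rule ccontr)
    assume "v \<notin> S"
    have "S \<subseteq> X" using walk_in_closed aX unfolding S_def by blast
    then obtain c d where cd: "c \<in> S" "d \<in> X - S" "E c d"
      using no_cutvertex[of S u] V \<open>v \<notin> S\<close> unfolding X_def S_def by blast
    then have "(c, d) \<in> walk_in X" using \<open>S \<subseteq> X\<close> by (auto simp: walk_in_def)
    then show False using cd unfolding S_def by (auto intro: rtrancl_into_rtrancl)
  qed
  then obtain Q where Q: "distinct Q" "successively oadj Q" "Q \<noteq> []" "hd Q = a" "last Q = v" "set Q \<subseteq> X"
    using path_in[of a v X] V unfolding S_def X_def by auto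
  have "length Q \<ge> 2" using Q a(1) by (cases Q rule: remdups_adj.cases) auto
  then have "ocyc (u # Q)"
    using Q uv oadj_E[OF a(2)] unfolding ocyc_def X_def by (auto simp: cyc_simps oadj_comm)
  then show ?thesis using Q(3,5) last_in_set[of Q] by (intro exI[of _ "u # Q"]) auto
qed

text \<open>Three or more heavy vertices form an o-cycle in any order, being pairwise o-adjacent. At
  most two of them lie on a single o-edge, and \<open>cycle_through\<close> applies.\<close>

lemma ex_extremal: "\<exists>C. extremal C"
proof -
  define H where "H = {v. heavy v}"
  have fH: "finite H" using fin by (rule rev_finite_subset) (auto simp: H_def heavy_def)
  have "\<exists>C. ocyc C \<and> H \<subseteq> set C"
  proof (cases "3 \<le> card H")
    case True
    obtain xs where xs: "set xs = H" "distinct xs" using finite_distinct_list[OF fH] by blast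
    have "successively oadj ys" if "distinct ys" "set ys \<subseteq> H" for ys
      using that
    proof (induction ys)
      case (Cons y ys)
      then show ?case by (cases ys) (auto simp: H_def intro!: oadj_heavy)
    qed simp
    moreover have len: "3 \<le> length xs" using True xs distinct_card by metis
    moreover have "oadj (last xs) (hd xs)"
    proof (rule oadj_heavy)
      have "xs \<noteq> []" using len by auto
      then show "heavy (last xs)" "heavy (hd xs)" using xs(1) by (auto simp: H_def)
      show "last xs \<noteq> hd xs" using len xs(2) by (cases xs) auto
    qed
    ultimately show ?thesis using xs unfolding ocyc_def by blast
  next
    case False
    have "\<exists>u v. oadj u v \<and> H \<subseteq> {u, v}"
    proof (cases "card H = 2")
      case True
      then obtain u v where "H = {u, v}" "u \<noteq> v" by (meson card_2_iff)
      then show ?thesis using oadj_heavy[of u v] by (auto simp: H_def)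
    next
      case False
      then have "card H \<le> Suc 0" using \<open>\<not> 3 \<le> card H\<close> by linarith
      moreover have "V \<noteq> {}" using card3 by auto
      ultimately obtain u where u: "u \<in> V" "H \<subseteq> {u}"
        using card_le_Suc0_iff_eq[OF fH] by (cases "H = {}") (auto simp: H_def heavy_def)
      have "V \<noteq> {u}" using card3 by auto
      then obtain w where "w \<noteq> u" using u by auto
      then show ?thesis using ex_nbr[OF u(1)] u(2) oadj_E by blast
    qed
    then show ?thesis using cycle_through by blast
  qed
  then show ?thesis using ex_extremal_from unfolding H_def by blast
qed

lemma extremal_spanning:
  assumes C: "extremal C" shows "set C = V"
proof (rule ccontr)
  assume "set C \<noteq> V"
  moreover have CV: "set C \<subseteq> V" using ocyc_subset extremal_ocyc[OF C] .
  ultimately obtain r0 where r0: "r0 \<in> V - set C" by blast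
  define X where "X = V - set C"
  define R where "R = (walk_in X)\<^sup>* `` {r0}"
  have RX: "R \<subseteq> X" using walk_in_closed r0 unfolding R_def X_def by blast
  have R0: "r0 \<in> R" by (simp add: R_def)
  have Rstep: "b \<in> R" if "a \<in> R" "E a b" "b \<notin> set C" for a b
  proof -
    have "(a, b) \<in> walk_in X" using that RX E_V2 unfolding walk_in_def X_def by blast
    then show ?thesis using that(1) unfolding R_def by (auto intro: rtrancl_into_rtrancl)
  qed
  have Rconn: "(a, b) \<in> (walk_in X)\<^sup>*" if "a \<in> R" "b \<in> R" for a b
  proof -
    have "(r0, a) \<in> (walk_in X)\<^sup>*" "(r0, b) \<in> (walk_in X)\<^sup>*" using that by (auto simp: R_def)
    then show ?thesis by (meson walk_in_sym rtrancl_trans)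
  qed
  have Rpath: "\<exists>Q. distinct Q \<and> successively oadj Q \<and> Q \<noteq> [] \<and> hd Q = a \<and> last Q = b \<and> set Q \<subseteq> X"
    if "a \<in> R" "b \<in> R" for a b
  proof (rule path_in[OF Rconn[OF that]])
    show "b \<in> X" using that RX by blast
  qed
  \<comment> \<open>Otherwise \<open>u\<close> would separate \<open>R\<close> from the rest of the
    cycle.\<close>
  have att: "\<exists>r\<in>R. \<exists>y\<in>set C. y \<noteq> u \<and> E r y" if u: "u \<in> set C" for u
  proof -
    obtain L where L: "extremal (u # L)" "set (u # L) = set C" using extremal_split[OF C u] .
    have "hd L \<in> V - {u} - R"
      using extremal_len[OF L(1)] extremal_distinct[OF L(1)] L(2) CV RX hd_in_set[of L]
      unfolding X_def by auto
    then obtain a b where "a \<in> R" "b \<in> V - {u} - R" "E a b"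
      using no_cutvertex[of R u] R0 RX u unfolding X_def by blast
    then show ?thesis using Rstep by blast
  qed
  have sum: "card V \<le> dg (hd L) + dg (last L)"
    if L: "extremal (x # L)" "set (x # L) = set C" and r: "r \<in> R" "E x r" for x L r
  proof -
    \<comment> \<open>These are the vertices needed for \<open>nbrs_sum\<close>. Without them,
      adjacency to \<open>x\<close> would spread over all of \<open>R\<close> and on to a second
      attachment \<open>y\<close>, so \<open>x\<close>, \<open>y\<close> and a vertex of
      \<open>R\<close> would contradict \<open>no_triangle\<close>.\<close>
    have "\<exists>r'\<in>R. E x r' \<and> (\<exists>s. E r' s \<and> s \<noteq> x \<and> \<not> E x s)"
    proof (rule ccontr)
      assume "\<not> ?thesis"
      then have n: "s = x \<or> E x s" if "r' \<in> R" "E x r'" "E r' s" for r' s using that by blast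
      have xR: "E x b" if "b \<in> R" for b
      proof -
        have "(r, b) \<in> (walk_in X)\<^sup>*"
          by (rule Rconn[OF r(1) that])
        then have "b \<in> R \<and> E x b"
        proof (induction rule: rtrancl_induct)
          case (step b c)
          then have "E b c" "c \<notin> set C" by (auto simp: walk_in_def X_def)
          then show ?case using step.IH Rstep n[of b c] L(2) by auto
        qed (use r in simp)
        then show ?thesis by simp
      qed
      obtain r' y where y: "r' \<in> R" "y \<in> set C" "y \<noteq> x" "E r' y"
        using att[of x] L(2) by auto
      then obtain S T where ST: "L = S @ y # T" using L(2) by (metis set_ConsD split_list)
      have "r' \<notin> set (x # S @ y # T)" using y(1) RX L(2) unfolding X_def ST by blast
      then show False
        using no_triangle[of x S y T r'] L(1) xR[OF y(1)] y n[OF y(1) _ y(4)] E_comm unfolding ST by blast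
    qed
    then obtain r' s where "r' \<in> R" "E x r'" "E r' s" "s \<noteq> x" "\<not> E x s" by blast
    then show ?thesis using nbrs_sum[OF L(1)] RX L(2) unfolding X_def by blast
  qed
  have "C \<noteq> []" using extremal_ocyc[OF C] by (auto simp: ocyc_def)
  then obtain x rx where x: "x \<in> set C" "rx \<in> R" "E rx x"
    using att[of "hd C"] by auto
  obtain y ry where y: "y \<in> set C" "y \<noteq> x" "ry \<in> R" "E ry y"
    using att[OF x(1)] by blast
  obtain L where L: "extremal (x # L)" "set (x # L) = set C" using extremal_split[OF C x(1)] .
  obtain S T where ST: "L = S @ y # T" using L(2) y(1,2) by (metis set_ConsD split_list)
  have g: "extremal (x # S @ y # T)" and sC: "set (x # S @ y # T) = set C" using L unfolding ST by auto
  obtain Q where Q: "distinct Q" "successively oadj Q" "Q \<noteq> []" "hd Q = rx" "last Q = ry" "set Q \<subseteq> X"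
    using Rpath[OF x(2) y(3)] by blast
  have dis: "set Q \<inter> set (x # S @ y # T) = {}" using Q(6) sC unfolding X_def by blast
  have xQ: "oadj x (hd Q)" and yQ: "oadj (last Q) y"
    using Q(4,5) x(3) y(4) oadj_E E_comm by auto
  note t = two_attachments[OF g Q(1-3) dis xQ yQ] two_attachments_last[OF g Q(1-3) dis xQ yQ]
  have d: "hd S \<noteq> hd T" "last S \<noteq> last T" "hd S \<in> V" "hd T \<in> V" "last S \<in> V" "last T \<in> V"
  proof -
    have i: "hd S \<in> set S" "hd T \<in> set T" "last S \<in> set S" "last T \<in> set T" using t by auto
    moreover have "set S \<inter> set T = {}" using extremal_distinct[OF g] by auto
    ultimately show "hd S \<noteq> hd T" "last S \<noteq> last T" by auto
    show "hd S \<in> V" "hd T \<in> V" "last S \<in> V" "last T \<in> V" using i CV sC by auto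
  qed
  \<comment> \<open>The neighbours of \<open>x\<close> on the cycle are \<open>hd S\<close> and
    \<open>last T\<close>, those of \<open>y\<close> are \<open>hd T\<close> and
    \<open>last S\<close>. Both pairings bound the same sum of four degrees, once from above and
    once from below.\<close>
  have "dg (hd S) + dg (hd T) < card V" "dg (last S) + dg (last T) < card V"
    using t d by (auto simp: oadj_def)
  moreover have "card V \<le> dg (hd S) + dg (last T)"
    using sum[OF g sC x(2)] x(3) E_comm t by auto
  moreover have "card V \<le> dg (hd T) + dg (last S)"
    using sum[OF extremal_swap[OF g] _ y(3)] y(4) E_comm t sC by (auto simp: insert_commute Un_commute)
  ultimately show False by linarith
qed

theorem ex_hamilton_cycle:
  "\<exists>C. 3 \<le> length C \<and> distinct C \<and> successively E C \<and> E (last C) (hd C) \<and> set C = V"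
proof -
  obtain C where C: "extremal C" using ex_extremal by blast
  have "successively E C \<and> E (last C) (hd C)" using C by (simp add: extremal_def)
  then show ?thesis
    using extremal_ocyc[OF C] extremal_spanning[OF C] unfolding ocyc_def by blast
qed

end

section \<open>Induced claws and Z2 in library graphs\<close>

text \<open>Stays within pair digraphs, the type over which \<open>o_heavy\<close> quantifies its
  subgraphs.\<close>

definition induce :: "'a pair_pre_digraph \<Rightarrow> 'a set \<Rightarrow> 'a pair_pre_digraph" where
  "induce G W = \<lparr> pverts = W, parcs = {e \<in> parcs G. fst e \<in> W \<and> snd e \<in> W} \<rparr>"

lemma induce_simps [simp]:
  "pverts (induce G W) = W"
  "(u, v) \<in> parcs (induce G W) \<longleftrightarrow> (u, v) \<in> parcs G \<and> u \<in> W \<and> v \<in> W"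
  by (auto simp: induce_def)

lemma parcs_induce_subset: "parcs (induce G W) \<subseteq> W \<times> W"
  by (auto simp: induce_def)

lemma wf_induce: "wf_digraph (with_proj (induce G W))"
  unfolding wf_digraph_wp_iff by unfold_locales (auto simp: induce_def)

lemma degree_eq_card_nbhd: "degree G v = card (nbhd G v)"
proof -
  have "out_arcs (with_proj G) v = Pair v ` nbhd G v"
    by (auto simp: out_arcs_def nbhd_def)
  then show ?thesis by (simp add: out_degree_def card_image inj_on_def)
qed

text \<open>If no arc left \<open>S\<close>, a walk starting in \<open>S\<close> would stay there.
  Symmetry of \<open>G\<close> absorbs the symmetric closure in the notion of connectedness.\<close>

lemma connected_cut:
  assumes c: "Digraph_Component.connected (with_proj G \<restriction> U)" and G: "pair_sym_digraph G"
    and S: "S \<subseteq> U" "S \<noteq> {}" "U - S \<noteq> {}"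
  shows "\<exists>a\<in>S. \<exists>b\<in>U - S. (a, b) \<in> parcs G"
proof (rule ccontr)
  assume n: "\<not> ?thesis"
  obtain s t where st: "s \<in> S" "t \<in> U - S" using S by blast
  have "(s, t) \<in> rtrancl_on U ((arcs_ends (with_proj G \<restriction> U))\<^sup>s)"
    using c st S(1) by (auto simp: connected_conv)
  then have "t \<in> S"
  proof (induction rule: rtrancl_on_induct)
    case (step y z)
    then have "(y, z) \<in> parcs G"
      using pair_sym_digraph.arcs_symmetric[OF G]
      by (auto simp: symcl_def arcs_ends_conv)
    then show ?case using step n by blast
  qed (use st in simp)
  then show False using st by simp
qed

context pair_graph begin

lemma not_arc_sym: "(a, b) \<notin> parcs G \<Longrightarrow> (b, a) \<notin> parcs G"
  using arcs_symmetric[of b a] by blast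

lemma induced_subgraph_induce:
  assumes "W \<subseteq> pverts G"
  shows "induced_subgraph (with_proj (induce G W)) (with_proj G)"
  using assms wf_digraph wf_induce[of G W] by (auto simp: induced_subgraph_def subgraph_def induce_def)

lemma claw_induce:
  assumes E: "(c, a) \<in> parcs G" "(c, b) \<in> parcs G" "(c, d) \<in> parcs G"
    and abd: "distinct [a, b, d]" "(a, b) \<notin> parcs G" "(a, d) \<notin> parcs G" "(b, d) \<notin> parcs G"
  shows "claw (induce G {c, a, b, d})" "claw_ends (induce G {c, a, b, d}) \<subseteq> {a, b, d}"
proof -
  have c: "c \<noteq> a" "c \<noteq> b" "c \<noteq> d" using E no_loops' by auto
  have irr: "(u, u) \<notin> parcs G" for u using no_loops' by blast
  note E' = E[THEN arcs_symmetric]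
  note abd' = abd(2-4)[THEN not_arc_sym]
  have "parcs (induce G {c, a, b, d}) = {c} \<times> {a, b, d} \<union> {a, b, d} \<times> {c}" (is "_ = ?A")
  proof
    have "(u, v) \<in> ?A" if "(u, v) \<in> parcs G" "u \<in> {c, a, b, d}" "v \<in> {c, a, b, d}" for u v
      using that by (elim insertE emptyE) (simp_all add: irr abd abd')
    then show "parcs (induce G {c, a, b, d}) \<subseteq> ?A" by (intro subrelI) simp
    show "?A \<subseteq> parcs (induce G {c, a, b, d})"
      by (simp add: induce_def E E')
  qed
  note arcs = this
  have card: "card {a, b, d} = 3" using abd(1) by simp
  have "\<exists>U V. pverts (induce G {c, a, b, d}) = U \<union> V \<and> U \<inter> V = {} \<and> card U = 1 \<and> card V = 3 \<and>
      parcs (induce G {c, a, b, d}) = U \<times> V \<union> V \<times> U"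
    by (rule exI[of _ "{c}"], rule exI[of _ "{a, b, d}"]) (use c card arcs in \<open>simp add: insert_commute\<close>)
  then show "claw (induce G {c, a, b, d})"
    unfolding claw_def complete_bipartite_digraph_pair_def by simp
  have "nbhd (induce G {c, a, b, d}) c = {a, b, d}"
    unfolding nbhd_def arcs using c by auto
  then have "degree (induce G {c, a, b, d}) c = 3"
    using card by (simp add: degree_eq_card_nbhd)
  then show "claw_ends (induce G {c, a, b, d}) \<subseteq> {a, b, d}"
    by (auto simp: claw_ends_def)
qed

lemma Z2_induce:
  assumes E: "(a1, a2) \<in> parcs G" "(a1, a3) \<in> parcs G" "(a2, a3) \<in> parcs G" "(a1, b) \<in> parcs G"
      "(b, c) \<in> parcs G"
    and d: "distinct [a1, a2, a3, b, c]"
    and n: "(a2, b) \<notin> parcs G" "(a3, b) \<notin> parcs G" "(a1, c) \<notin> parcs G" "(a2, c) \<notin> parcs G"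
      "(a3, c) \<notin> parcs G"
  shows "digraph_iso (with_proj (induce G {a1, a2, a3, b, c})) (with_proj Z2)"
    (is "digraph_iso (with_proj ?H) _")
proof -
  have irr: "(u, u) \<notin> parcs G" for u using no_loops' by blast
  note E' = E[THEN arcs_symmetric]
  note n' = n[THEN not_arc_sym]
  have arcs: "parcs ?H = {(a1, a2), (a1, a3), (a2, a3), (a1, b), (b, c)}\<^sup>s" (is "_ = ?A")
  proof
    have "(u, v) \<in> ?A"
      if "(u, v) \<in> parcs G" "u \<in> {a1, a2, a3, b, c}" "v \<in> {a1, a2, a3, b, c}" for u v
      using that by (elim insertE emptyE) (simp_all add: irr n n' symcl_def)
    then show "parcs ?H \<subseteq> ?A" by (intro subrelI) simp
    show "?A \<subseteq> parcs ?H"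
      by (simp add: induce_def symcl_def E E')
  qed
  define f where "f v = (if v = a1 then A1 else if v = a2 then A2 else if v = a3 then A3
    else if v = b then B1 else C1)" for v
  define h where "h = \<lparr> iso_verts = f, iso_arcs = map_prod f f, iso_head = snd, iso_tail = fst \<rparr>"
  have f: "f a1 = A1" "f a2 = A2" "f a3 = A3" "f b = B1" "f c = C1"
    using d by (auto simp: f_def)
  have inj: "inj_on f {a1, a2, a3, b, c}" using f by (auto simp: inj_on_def)
  have "inj_on (map_prod f f) (parcs ?H)"
    by (rule inj_on_subset[OF map_prod_inj_on[OF inj inj] parcs_induce_subset])
  then have "pre_digraph.digraph_isomorphism (with_proj ?H) h"
    using inj wf_induce by (simp add: pre_digraph.digraph_isomorphism_def h_def del: inj_on_insert)
  moreover have "with_proj Z2 = app_iso h (with_proj ?H)"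
    by (simp add: app_iso_def h_def with_proj_def Z2_def arcs f symcl_def)
  ultimately show ?thesis unfolding digraph_iso_def by blast
qed

end

section \<open>Distance two and Hamiltonian cycles in library graphs\<close>

lemma graph_dist_eq_2:
  assumes H: "wf_digraph (with_proj H)" and uv: "u \<noteq> v" "(u, v) \<notin> parcs H"
    and w: "(u, w) \<in> parcs H" "(w, v) \<in> parcs H"
  shows "graph_dist H u v = 2"
proof -
  interpret wf_digraph "with_proj H" by (rule H)
  have cost: "awalk_cost (\<lambda>_. 1) p = real (length p)" for p
    by (simp add: awalk_cost_def sum_list_triv)
  have v: "v \<in> pverts H" using w head_in_verts[of "(w, v)"] by simp
  have "awalk u [(u, w), (w, v)] v"
    using w v by (simp add: awalk_Cons_iff awalk_Nil_iff)
  then have "\<mu> (\<lambda>_. 1) u v \<le> 2"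
    using min_cost_le_walk_cost[of u "[(u, w), (w, v)]" v "\<lambda>_. 1"] by (simp add: cost)
  moreover have "2 \<le> \<mu> (\<lambda>_. 1) u v"
    unfolding \<mu>_def
  proof (rule INF_greatest)
    fix p assume "p \<in> {p. awalk u p v}"
    then have p: "awalk u p v" by simp
    \<comment> \<open>An empty walk would give \<open>u = v\<close>, and a walk of length one would
      be the arc \<open>(u, v)\<close>.\<close>
    have "2 \<le> length p"
    proof (cases p)
      case Nil
      then show ?thesis using p uv(1) by (simp add: awalk_Nil_iff)
    next
      case (Cons e es)
      then show ?thesis using p uv(2) by (cases es) (auto simp: awalk_Cons_iff awalk_Nil_iff)
    qed
    then show "2 \<le> ereal (awalk_cost (\<lambda>_. 1) p)" by (simp add: cost)
  qed
  ultimately show ?thesis unfolding graph_dist_def by (rule antisym)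
qed

text \<open>The \<open>zip\<close> pairs each vertex with its successor and the last one with
  \<open>v\<close>. Taking \<open>v = hd xs\<close> gives the closed walk around a vertex
  list.\<close>

lemma walk_of_verts:
  assumes "xs \<noteq> []"
  shows "pcas (hd xs) (zip xs (tl xs @ [v])) v \<and> pawalk_verts (hd xs) (zip xs (tl xs @ [v])) = xs @ [v]"
  using assms
proof (induction xs)
  case (Cons x xs)
  then show ?case by (cases xs) auto
qed simp

lemma arcs_of_verts:
  assumes "successively (\<lambda>a b. (a, b) \<in> A) xs" "(last xs, v) \<in> A"
  shows "set (zip xs (tl xs @ [v])) \<subseteq> A"
  using assms
proof (induction xs)
  case (Cons x xs)
  then show ?case by (cases xs) auto
qed simp

lemma hamiltonianI:
  assumes G: "pair_wf_digraph G"
    and C: "3 \<le> length C" "distinct C" "successively (\<lambda>a b. (a, b) \<in> parcs G) C"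
      "(last C, hd C) \<in> parcs G" "set C = pverts G"
  shows "hamiltonian G"
proof -
  interpret pair_wf_digraph G by (rule G)
  define p where "p = zip C (tl C @ [hd C])"
  have C0: "C \<noteq> []" using C(1) by auto
  have l: "length p = length C" using C0 by (simp add: p_def)
  have "awalk (hd C) p (hd C)"
    using walk_of_verts[OF C0] arcs_of_verts[OF C(3,4)] C0 C(5) hd_in_set[OF C0]
    by (simp add: awalk_def p_def)
  \<comment> \<open>The closed walk visits \<open>hd C\<close> first and last. Without its first
    entry, the vertex list is a rotation of \<open>C\<close>.\<close>
  moreover have "distinct (tl (awalk_verts (hd C) p))"
    using walk_of_verts[OF C0, of "hd C"] C(2) C0 unfolding p_def by (cases C) auto
  moreover have "p \<noteq> []" using l C(1) by auto
  ultimately have "cycle p" unfolding cycle_def by blast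
  moreover have "fst ` set p = pverts G"
    using C(5) C0 unfolding p_def by (simp flip: set_map)
  ultimately show ?thesis using l C(1) unfolding hamiltonian_def by auto
qed

theorem theorem9:
  fixes G :: "'a pair_pre_digraph" and n :: nat
  assumes "pair_graph G"
    and "n = card (pverts G)" and "n \<ge> 3"
    and "k_connected 2 G"
    and "o_heavy G"
    and "\<And>(H :: 'a pair_pre_digraph) u v.
           \<lbrakk> induced_subgraph (with_proj H) (with_proj G); digraph_iso (with_proj H) (with_proj Z2);
             u \<in> pverts H; v \<in> pverts H; graph_dist H u v = 2 \<rbrakk>
           \<Longrightarrow> real (max (degree G u) (degree G v)) \<ge> real n / 2 \<or> card (nbhd G u \<inter> nbhd G v) \<ge> 2"
  shows "hamiltonian G"
proof -
  interpret pair_graph G by (rule assms(1))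
  let ?E = "\<lambda>a b. (a, b) \<in> parcs G"
  interpret H: finite_graph "pverts G" ?E
    by unfold_locales (use arcs_symmetric no_loops' in_arcsD1 in auto)
  have dg: "H.dg v = degree G v" for v by (simp add: H.dg_def degree_eq_card_nbhd nbhd_def)
  have fin_nbhd: "finite (nbhd G u)" for u using H.finite_nbrs by (simp add: nbhd_def)
  interpret H: two_connected_Z2_graph "pverts G" ?E
  proof
    show "3 \<le> card (pverts G)" using assms(2,3) by simp
  next
    fix S u assume S: "S \<subseteq> pverts G - {u}" "S \<noteq> {}" "pverts G - {u} - S \<noteq> {}"
    \<comment> \<open>The intersection covers the case that \<open>u\<close> is not a vertex, as
      \<open>k_connected\<close> only removes subsets of \<open>pverts G\<close>.\<close>
    have "card (pverts G \<inter> {u}) < 2"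
      using card_mono[of "{u}" "pverts G \<inter> {u}"] by simp
    then have "Digraph_Component.connected (with_proj G \<restriction> (pverts G - (pverts G \<inter> {u})))"
      using assms(4) unfolding k_connected_def by blast
    then have "Digraph_Component.connected (with_proj G \<restriction> (pverts G - {u}))"
      by (simp add: Diff_Int)
    then show "\<exists>a\<in>S. \<exists>b\<in>pverts G - {u} - S. (a, b) \<in> parcs G"
      using connected_cut[OF _ pair_sym_digraph_axioms S] by blast
  next
    fix c a b d
    assume E: "?E c a" "?E c b" "?E c d" and abd: "distinct [a, b, d]" "\<not> ?E a b" "\<not> ?E a d" "\<not> ?E b d"
    let ?H = "induce G {c, a, b, d}"
    have V: "{c, a, b, d} \<subseteq> pverts G" using E in_arcsD1 in_arcsD2 by auto
    obtain x y where xy: "x \<in> claw_ends ?H" "y \<in> claw_ends ?H" "x \<noteq> y"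
      "card (pverts G) \<le> degree G x + degree G y"
      using assms(5) induced_subgraph_induce[OF V] claw_induce(1)[OF E abd] unfolding o_heavy_def by blast
    then have "H.oadj x y" "x \<in> {a, b, d}" "y \<in> {a, b, d}"
      using claw_induce(2)[OF E abd] V by (auto simp: H.oadj_def dg)
    then show "H.oadj a b \<or> H.oadj a d \<or> H.oadj b d"
      using xy(3) H.oadj_comm by auto
  next
    fix a1 a2 a3 b c
    assume d: "distinct [a1, a2, a3, b, c]"
      and E: "?E a1 a2" "?E a1 a3" "?E a2 a3" "?E a1 b" "?E b c"
      and n: "\<not> ?E a2 b" "\<not> ?E a3 b" "\<not> ?E a1 c" "\<not> ?E a2 c" "\<not> ?E a3 c"
    let ?H = "induce G {a1, a2, a3, b, c}"
    have V: "{a1, a2, a3, b, c} \<subseteq> pverts G" using E in_arcsD1 in_arcsD2 by auto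
    have ind: "induced_subgraph (with_proj ?H) (with_proj G)" by (rule induced_subgraph_induce[OF V])
    then have "wf_digraph (with_proj ?H)" by (simp add: induced_subgraph_def subgraph_def)
    then have "graph_dist ?H a2 b = 2"
      by (rule graph_dist_eq_2[where w = a1]) (use d E n arcs_symmetric in auto)
    then consider "real n / 2 \<le> real (max (degree G a2) (degree G b))" | "2 \<le> card (nbhd G a2 \<inter> nbhd G b)"
      using assms(6)[OF ind Z2_induce[OF E d n], of a2 b] by auto
    then show "H.heavy a2 \<or> H.heavy b \<or> (\<exists>z. z \<noteq> a1 \<and> ?E a2 z \<and> ?E b z)"
    proof cases
      case 1
      then show ?thesis using V assms(2) by (auto simp: H.heavy_def dg max_def split: if_splits)
    next
      case 2
      have "\<not> nbhd G a2 \<inter> nbhd G b \<subseteq> {a1}"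
      proof
        assume "nbhd G a2 \<inter> nbhd G b \<subseteq> {a1}"
        then show False using card_mono[of "{a1}" "nbhd G a2 \<inter> nbhd G b"] 2 by simp
      qed
      then show ?thesis by (auto simp: nbhd_def)
    qed
  qed
  obtain C where "3 \<le> length C" "distinct C" "successively ?E C" "?E (last C) (hd C)" "set C = pverts G"
    using H.ex_hamilton_cycle by blast
  then show ?thesis by (rule hamiltonianI[OF pair_wf_digraph])
qed

end
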